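(* Let $G$ be a non-trivial periodic group with set of minimal subgroups $\Omega_G=\{H_i\}_{i\in I}$. For any $A=\{H_ia_i\}_{i\in I}$ and $B=\{H_ib_i\}_{i\in I}$ in $\mathcal A_G$, $$A\cdot B=\{H_ia_ib_{i^{\tau_A}}\}_{i\in I},$$ where the transformation $\tau_A$ of $I$, defined by $i^{\tau_A}=j$ whenever $H_j=H_i^{a_i}$, is a permutation of $I$; and the map $\tau:\mathcal A_G\to Sym(I)$ defined by $\tau(A)=\tau_A$ is a group homomorphism.
   Context: For $K\le G$, $g\in G$ write $K^g=g^{-1}Kg$. $\mathcal K_1(G)$ is the set of all right cosets $Ha$ of all non-trivial subgroups $H$ of $G$ with operation $Ha*Kb=\langle H,K^{a^{-1}}\rangle ab$; it is an inverse semigroup whose idempotents are the non-trivial subgroups of $G$, with natural partial order $Ha\le_n Kb\iff Kb\subseteq Ha$, and with Green's relation $Ha\,\mathcal L\,Kb\iff H^a=K^b$. $L_H$ denotes the $\mathcal L$-class of $H$. Elements $x,y$ of an inverse semigroup are compatible, $x\sim y$, if $xy^{-1}$ and $x^{-1}y$ are both idempotents. For $A\subseteq\mathcal K_1(G)$, $[A]$ is the order ideal generated by $A$ (all elements lying $\le_n$-below some element of $A$), and $\overline A$ is the set of maximal elements of $A$ with respect to $\le_n$. Minimal subgroup means minimal non-trivial subgroup; the $H_i$ ($i\in I$) are pairwise distinct. $$\mathcal A_G=\{\{H_ia_i\}_{i\in I}\mid a_i\in G,\ (\forall j,k\in I)\ H_ja_j\sim H_ka_k\text{ and }|\{H_ia_i\}_{i\in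 I}\cap L_{H_j}|=1\}.$$ $\mathcal A_G$ is a group under the multiplication $A\cdot B=\overline{[A][B]}$, where $[A][B]=\{x*y\mid x\in[A],y\in[B]\}$. Permutations of $I$ act on the right, written as exponents, and are composed from left to right: $i^{\sigma\rho}=(i^{\sigma})^{\rho}$. *)

theory Defs
  imports "HOL-Algebra.Generated_Groups" "HOL-Algebra.Bij"
begin

section \<open>Notions from the theory of inverse semigroups\<close>

text \<open>
  A semigroup is given by a carrier set \<open>S\<close> and a multiplication \<open>f\<close>; only the values of \<open>f\<close>
  on \<open>S\<close> matter.
\<close>

definition idempotents :: "'s set \<Rightarrow> ('s \<Rightarrow> 's \<Rightarrow> 's) \<Rightarrow> 's set" where
  "idempotents S f = {e \<in> S. f e e = e}"

definition sg_inv :: "'s set \<Rightarrow> ('s \<Rightarrow> 's \<Rightarrow> 's) \<Rightarrow> 's \<Rightarrow> 's" where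
  "sg_inv S f x = (THE y. y \<in> S \<and> f (f x y) x = x \<and> f (f y x) y = y)"

definition nat_le :: "'s set \<Rightarrow> ('s \<Rightarrow> 's \<Rightarrow> 's) \<Rightarrow> 's \<Rightarrow> 's \<Rightarrow> bool" where
  "nat_le S f x y \<longleftrightarrow> x \<in> S \<and> y \<in> S \<and> (\<exists>e \<in> idempotents S f. x = f e y)"

definition compatible :: "'s set \<Rightarrow> ('s \<Rightarrow> 's \<Rightarrow> 's) \<Rightarrow> 's \<Rightarrow> 's \<Rightarrow> bool" where
  "compatible S f x y \<longleftrightarrow> x \<in> S \<and> y \<in> S \<and>
     f x (sg_inv S f y) \<in> idempotents S f \<and> f (sg_inv S f x) y \<in> idempotents S f"

text \<open>Green's relation: \<open>x\<close> and \<open>y\<close> generate the same principal left ideal.\<close>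

definition green_L :: "'s set \<Rightarrow> ('s \<Rightarrow> 's \<Rightarrow> 's) \<Rightarrow> 's \<Rightarrow> 's \<Rightarrow> bool" where
  "green_L S f x y \<longleftrightarrow> x \<in> S \<and> y \<in> S \<and>
     insert x ((\<lambda>s. f s x) ` S) = insert y ((\<lambda>s. f s y) ` S)"

definition order_ideal :: "'s set \<Rightarrow> ('s \<Rightarrow> 's \<Rightarrow> 's) \<Rightarrow> 's set \<Rightarrow> 's set" where
  "order_ideal S f A = {x \<in> S. \<exists>y \<in> A. nat_le S f x y}"

definition maximal_elements :: "'s set \<Rightarrow> ('s \<Rightarrow> 's \<Rightarrow> 's) \<Rightarrow> 's set \<Rightarrow> 's set" where
  "maximal_elements S f A = {x \<in> A. \<forall>y \<in> A. nat_le S f x y \<longrightarrow> y = x}"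


section \<open>The coset semigroup\<close>

definition conjugate :: "('a, 'b) monoid_scheme \<Rightarrow> 'a set \<Rightarrow> 'a \<Rightarrow> 'a set" where
  "conjugate G K g = inv\<^bsub>G\<^esub> g <#\<^bsub>G\<^esub> K #>\<^bsub>G\<^esub> g"

definition nontriv_subgroups :: "('a, 'b) monoid_scheme \<Rightarrow> 'a set set" where
  "nontriv_subgroups G = {H. subgroup H G \<and> H \<noteq> {\<one>\<^bsub>G\<^esub>}}"

definition K1 :: "('a, 'b) monoid_scheme \<Rightarrow> 'a set set" where
  "K1 G = {H #>\<^bsub>G\<^esub> a | H a. H \<in> nontriv_subgroups G \<and> a \<in> carrier G}"

text \<open>
  The product is specified by representatives; the lemma \<open>K1_mult_eq\<close> below shows that it is
  well defined.
\<close>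

definition K1_mult :: "('a, 'b) monoid_scheme \<Rightarrow> 'a set \<Rightarrow> 'a set \<Rightarrow> 'a set" where
  "K1_mult G X Y = (THE Z. \<exists>H \<in> nontriv_subgroups G. \<exists>K \<in> nontriv_subgroups G.
     \<exists>a \<in> carrier G. \<exists>b \<in> carrier G. X = H #>\<^bsub>G\<^esub> a \<and> Y = K #>\<^bsub>G\<^esub> b \<and>
       Z = generate G (H \<union> conjugate G K (inv\<^bsub>G\<^esub> a)) #>\<^bsub>G\<^esub> (a \<otimes>\<^bsub>G\<^esub> b))"

abbreviation K1_compatible :: "('a, 'b) monoid_scheme \<Rightarrow> 'a set \<Rightarrow> 'a set \<Rightarrow> bool" where
  "K1_compatible G \<equiv> compatible (K1 G) (K1_mult G)"

abbreviation K1_L_class :: "('a, 'b) monoid_scheme \<Rightarrow> 'a set \<Rightarrow> 'a set set" where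
  "K1_L_class G H \<equiv> {X. green_L (K1 G) (K1_mult G) X H}"


section \<open>Minimal subgroups and the group of compatible sets of cosets\<close>

definition periodic_group :: "('a, 'b) monoid_scheme \<Rightarrow> bool" where
  "periodic_group G \<longleftrightarrow> group G \<and> (\<forall>x \<in> carrier G. \<exists>n::nat. n > 0 \<and> x [^]\<^bsub>G\<^esub> n = \<one>\<^bsub>G\<^esub>)"

definition minimal_subgroups :: "('a, 'b) monoid_scheme \<Rightarrow> 'a set set" where
  "minimal_subgroups G = {H \<in> nontriv_subgroups G. \<forall>K \<in> nontriv_subgroups G. K \<subseteq> H \<longrightarrow> K = H}"

text \<open>
  In the following, \<open>H\<close> is a family, indexed by the set \<open>I\<close>, that enumerates the minimal
  subgroups of \<open>G\<close>.
\<close>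

definition coset_family ::
  "('a, 'b) monoid_scheme \<Rightarrow> 'i set \<Rightarrow> ('i \<Rightarrow> 'a set) \<Rightarrow> ('i \<Rightarrow> 'a) \<Rightarrow> 'a set set" where
  "coset_family G I H a = (\<lambda>i. H i #>\<^bsub>G\<^esub> a i) ` I"

definition compat_sets ::
  "('a, 'b) monoid_scheme \<Rightarrow> 'i set \<Rightarrow> ('i \<Rightarrow> 'a set) \<Rightarrow> 'a set set set" where
  "compat_sets G I H = {coset_family G I H a | a. a \<in> I \<rightarrow> carrier G \<and>
     (\<forall>j \<in> I. \<forall>k \<in> I. K1_compatible G (H j #>\<^bsub>G\<^esub> a j) (H k #>\<^bsub>G\<^esub> a k) \<and>
        card (coset_family G I H a \<inter> K1_L_class G (H j)) = 1)}"

definition compat_mult ::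
  "('a, 'b) monoid_scheme \<Rightarrow> 'a set set \<Rightarrow> 'a set set \<Rightarrow> 'a set set" where
  "compat_mult G A B = maximal_elements (K1 G) (K1_mult G)
     {K1_mult G X Y | X Y. X \<in> order_ideal (K1 G) (K1_mult G) A \<and>
                           Y \<in> order_ideal (K1 G) (K1_mult G) B}"

text \<open>The identity element is the set of all minimal subgroups (take \<open>a i = \<one>\<close> for all \<open>i\<close>).\<close>

definition compat_group ::
  "('a, 'b) monoid_scheme \<Rightarrow> 'i set \<Rightarrow> ('i \<Rightarrow> 'a set) \<Rightarrow> 'a set set monoid" where
  "compat_group G I H =
     \<lparr>carrier = compat_sets G I H, mult = compat_mult G, one = H ` I\<rparr>"

text \<open>
  \<^const>\<open>BijGroup\<close> composes from right to left. Permutations here act on the right and are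
  composed from left to right, so the multiplication has to be reversed.
\<close>

definition Sym :: "'i set \<Rightarrow> ('i \<Rightarrow> 'i) monoid" where
  "Sym I = \<lparr>carrier = carrier (BijGroup I),
            mult = (\<lambda>\<sigma> \<rho>. \<rho> \<otimes>\<^bsub>BijGroup I\<^esub> \<sigma>),
            one = \<one>\<^bsub>BijGroup I\<^esub>\<rparr>"

definition tau ::
  "('a, 'b) monoid_scheme \<Rightarrow> 'i set \<Rightarrow> ('i \<Rightarrow> 'a set) \<Rightarrow> 'a set set \<Rightarrow> 'i \<Rightarrow> 'i" where
  "tau G I H A = (\<lambda>i \<in> I. THE j. j \<in> I \<and>
     (\<exists>a \<in> carrier G. H i #>\<^bsub>G\<^esub> a \<in> A \<and> H j = conjugate G (H i) a))"


section \<open>The coset semigroup in terms of representatives\<close>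

context group
begin

lemma mem_conjugate_iff:
  assumes "K \<subseteq> carrier G" "g \<in> carrier G" "x \<in> carrier G"
  shows "x \<in> conjugate G K g \<longleftrightarrow> g \<otimes> x \<otimes> inv g \<in> K"
proof
  assume "x \<in> conjugate G K g"
  then obtain k where k: "k \<in> K" "x = inv g \<otimes> k \<otimes> g"
    unfolding conjugate_def r_coset_def l_coset_def by auto
  then have "k \<in> carrier G" using assms by auto
  then have "g \<otimes> x \<otimes> inv g = k" using k assms
    by (simp add: m_assoc) (simp add: m_assoc[symmetric])
  then show "g \<otimes> x \<otimes> inv g \<in> K" using k by simp
next
  assume *: "g \<otimes> x \<otimes> inv g \<in> K"
  have "x = inv g \<otimes> (g \<otimes> x \<otimes> inv g) \<otimes> g" using assms
    by (simp add: m_assoc) (simp add: m_assoc[symmetric])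
  with * show "x \<in> conjugate G K g"
    unfolding conjugate_def r_coset_def l_coset_def by auto
qed

lemma conjugate_subset:
  assumes "K \<subseteq> carrier G" "g \<in> carrier G"
  shows "conjugate G K g \<subseteq> carrier G"
  using assms unfolding conjugate_def
  by (simp add: l_coset_subset_G r_coset_subset_G)

lemma conjugate_conjugate:
  assumes "K \<subseteq> carrier G" "g \<in> carrier G" "h \<in> carrier G"
  shows "conjugate G (conjugate G K g) h = conjugate G K (g \<otimes> h)"
proof (intro Set.set_eqI)
  fix x
  show "x \<in> conjugate G (conjugate G K g) h \<longleftrightarrow> x \<in> conjugate G K (g \<otimes> h)"
  proof (cases "x \<in> carrier G")
    case True
    then show ?thesis using assms
      by (simp add: mem_conjugate_iff conjugate_subset inv_mult_group m_assoc)
  next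
    case False
    then show ?thesis
      using conjugate_subset[OF conjugate_subset[OF assms(1,2)] assms(3)]
        conjugate_subset[OF assms(1) m_closed[OF assms(2,3)]] by blast
  qed
qed

lemma conjugate_one: "K \<subseteq> carrier G \<Longrightarrow> conjugate G K \<one> = K"
  unfolding conjugate_def by (simp add: lcos_mult_one coset_mult_one)

lemma conjugate_mono: "K \<subseteq> L \<Longrightarrow> conjugate G K g \<subseteq> conjugate G L g"
  unfolding conjugate_def r_coset_def l_coset_def by auto

lemma subgroup_conjugate:
  assumes "subgroup K G" "g \<in> carrier G"
  shows "subgroup (conjugate G K g) G"
proof -
  interpret K: subgroup K G by fact
  have sub: "conjugate G K g \<subseteq> carrier G" by (rule conjugate_subset) (use assms in auto)
  show ?thesis
  proof (rule subgroupI)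
    show "conjugate G K g \<subseteq> carrier G" by fact
    have "\<one> \<in> conjugate G K g" using assms by (simp add: mem_conjugate_iff K.subset)
    then show "conjugate G K g \<noteq> {}" by auto
  next
    fix x assume x: "x \<in> conjugate G K g"
    then have xc: "x \<in> carrier G" using sub by auto
    have "inv (g \<otimes> x \<otimes> inv g) \<in> K" using x xc assms by (simp add: mem_conjugate_iff K.subset)
    then show "inv x \<in> conjugate G K g" using xc assms
      by (simp add: mem_conjugate_iff K.subset inv_mult_group m_assoc)
  next
    fix x y assume x: "x \<in> conjugate G K g" and y: "y \<in> conjugate G K g"
    then have xc: "x \<in> carrier G" "y \<in> carrier G" using sub by auto
    have "(g \<otimes> x \<otimes> inv g) \<otimes> (g \<otimes> y \<otimes> inv g) \<in> K" using x y xc assms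
      by (simp add: mem_conjugate_iff K.subset)
    moreover have "(g \<otimes> x \<otimes> inv g) \<otimes> (g \<otimes> y \<otimes> inv g) = g \<otimes> (x \<otimes> y) \<otimes> inv g"
      using xc assms by (simp add: m_assoc) (simp add: m_assoc[symmetric])
    ultimately show "x \<otimes> y \<in> conjugate G K g" using xc assms
      by (simp add: mem_conjugate_iff K.subset)
  qed
qed

lemma conjugate_self:
  assumes "subgroup K G" "g \<in> K"
  shows "conjugate G K g = K"
proof -
  interpret K: subgroup K G by fact
  have *: "conjugate G K h \<subseteq> K" if "h \<in> K" for h
    using that unfolding conjugate_def r_coset_def l_coset_def by auto
  have g: "g \<in> carrier G" using assms by auto
  have "K = conjugate G (conjugate G K (inv g)) g"
    using g K.subset by (simp add: conjugate_conjugate conjugate_one)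
  also have "\<dots> \<subseteq> conjugate G K g" using * assms by (intro conjugate_mono) auto
  finally show ?thesis using *[OF assms(2)] by blast
qed

lemma nontriv_conjugate:
  assumes "K \<in> nontriv_subgroups G" "g \<in> carrier G"
  shows "conjugate G K g \<in> nontriv_subgroups G"
proof -
  have K: "subgroup K G" "K \<noteq> {\<one>}" using assms by (auto simp: nontriv_subgroups_def)
  have "conjugate G {\<one>} (inv g) = {\<one>}"
    using assms unfolding conjugate_def r_coset_def l_coset_def by auto
  moreover have "conjugate G (conjugate G K g) (inv g) = K"
    using subgroup.subset[OF K(1)] assms by (simp add: conjugate_conjugate conjugate_one)
  ultimately have "conjugate G K g \<noteq> {\<one>}" using K(2) by metis
  then show ?thesis using K assms by (simp add: nontriv_subgroups_def subgroup_conjugate)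
qed

lemma nontriv_subset: "K \<in> nontriv_subgroups G \<Longrightarrow> K \<subseteq> carrier G"
  by (auto simp: nontriv_subgroups_def dest: subgroup.subset)

lemma nontriv_generate:
  assumes "H \<in> nontriv_subgroups G" "S \<subseteq> carrier G"
  shows "generate G (H \<union> S) \<in> nontriv_subgroups G"
proof -
  have sg: "subgroup (generate G (H \<union> S)) G"
    using assms nontriv_subset by (intro generate_is_subgroup) auto
  have "H \<subseteq> generate G (H \<union> S)" by (auto intro: generate.incl)
  moreover have "\<one> \<in> H" "H \<noteq> {\<one>}" using assms
    by (auto simp: nontriv_subgroups_def intro: subgroup.one_closed)
  ultimately show ?thesis using sg by (auto simp: nontriv_subgroups_def)
qed

lemma conjugate_subset_iff:
  assumes "K \<subseteq> carrier G" "L \<subseteq> carrier G" "g \<in> carrier G"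
  shows "conjugate G K g \<subseteq> L \<longleftrightarrow> K \<subseteq> conjugate G L (inv g)"
proof -
  have "conjugate G (conjugate G K g) (inv g) = K" "conjugate G (conjugate G L (inv g)) g = L"
    using assms by (simp_all add: conjugate_conjugate conjugate_one)
  then show ?thesis
    using conjugate_mono[of "conjugate G K g" L "inv g"]
      conjugate_mono[of K "conjugate G L (inv g)" g] by (intro iffI) (simp_all only:)
qed

lemma conjugate_generate:
  assumes "S \<subseteq> carrier G" "g \<in> carrier G"
  shows "conjugate G (generate G S) g = generate G (conjugate G S g)"
proof
  have sg: "subgroup (generate G T) G" if "T \<subseteq> carrier G" for T
    using that by (rule generate_is_subgroup)
  have le: "generate G (conjugate G T h) \<subseteq> conjugate G (generate G T) h"
    if T: "T \<subseteq> carrier G" "h \<in> carrier G" for T h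
  proof (rule generate_subgroup_incl)
    show "conjugate G T h \<subseteq> conjugate G (generate G T) h"
      by (intro conjugate_mono) (auto intro: generate.incl)
    show "subgroup (conjugate G (generate G T) h) G"
      using T sg by (intro subgroup_conjugate)
  qed
  show "generate G (conjugate G S g) \<subseteq> conjugate G (generate G S) g"
    by (rule le) (use assms in auto)
  have "generate G S = generate G (conjugate G (conjugate G S g) (inv g))"
    using assms by (simp add: conjugate_conjugate conjugate_one)
  also have "\<dots> \<subseteq> conjugate G (generate G (conjugate G S g)) (inv g)"
    using assms conjugate_subset by (intro le) auto
  finally show "conjugate G (generate G S) g \<subseteq> generate G (conjugate G S g)"
    using assms generate_incl[OF assms(1)] generate_incl[OF conjugate_subset[OF assms]]
    by (simp add: conjugate_subset_iff)
qed

lemma rcos_subset_iff: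
  assumes "subgroup H G" "subgroup K G" "a \<in> carrier G" "b \<in> carrier G"
  shows "K #> b \<subseteq> H #> a \<longleftrightarrow> K \<subseteq> H \<and> b \<otimes> inv a \<in> H"
proof -
  interpret H: subgroup H G by fact
  interpret K: subgroup K G by fact
  have mem: "x \<in> H #> a \<longleftrightarrow> x \<otimes> inv a \<in> H" if "x \<in> carrier G" for x
    using that assms(3) by (metis H.rcos_module is_group)
  show ?thesis
  proof
    assume *: "K #> b \<subseteq> H #> a"
    have kb: "k \<otimes> b \<otimes> inv a \<in> H" if "k \<in> K" for k
      using * that mem[of "k \<otimes> b"] assms(4) unfolding r_coset_def by auto
    then have ba: "b \<otimes> inv a \<in> H" using kb[OF K.one_closed] assms by simp
    have "k \<in> H" if "k \<in> K" for k
    proof -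
      have "k \<otimes> b \<otimes> inv a \<otimes> inv (b \<otimes> inv a) \<in> H" using kb[OF that] ba by blast
      also have "k \<otimes> b \<otimes> inv a \<otimes> inv (b \<otimes> inv a) = k"
        using that assms
        by (simp add: m_assoc inv_mult_group) (simp add: m_assoc[symmetric])
      finally show ?thesis .
    qed
    then show "K \<subseteq> H \<and> b \<otimes> inv a \<in> H" using ba by auto
  next
    assume *: "K \<subseteq> H \<and> b \<otimes> inv a \<in> H"
    show "K #> b \<subseteq> H #> a"
    proof
      fix x assume "x \<in> K #> b"
      then obtain k where k: "k \<in> K" "x = k \<otimes> b" unfolding r_coset_def by auto
      then have "k \<otimes> (b \<otimes> inv a) \<in> H" using * by auto
      then show "x \<in> H #> a" using k assms by (simp add: mem m_assoc)
    qed
  qed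
qed

lemma rcos_eq_iff:
  assumes "subgroup H G" "subgroup K G" "a \<in> carrier G" "b \<in> carrier G"
  shows "H #> a = K #> b \<longleftrightarrow> H = K \<and> b \<otimes> inv a \<in> H"
proof -
  interpret H: subgroup H G by fact
  have "b \<otimes> inv a \<in> H \<Longrightarrow> a \<otimes> inv b \<in> H"
    using assms H.m_inv_closed[of "b \<otimes> inv a"] by (simp add: inv_mult_group)
  then show ?thesis
    using rcos_subset_iff[OF assms] rcos_subset_iff[OF assms(2,1,4,3)] by auto
qed

theorem K1_mult_eq:
  assumes "H \<in> nontriv_subgroups G" "K \<in> nontriv_subgroups G" "a \<in> carrier G" "b \<in> carrier G"
  shows "K1_mult G (H #> a) (K #> b) = generate G (H \<union> conjugate G K (inv a)) #> (a \<otimes> b)"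
  unfolding K1_mult_def
proof (rule the_equality)
  show "\<exists>H'\<in>nontriv_subgroups G. \<exists>K'\<in>nontriv_subgroups G. \<exists>a'\<in>carrier G. \<exists>b'\<in>carrier G.
      H #> a = H' #> a' \<and> K #> b = K' #> b' \<and>
      generate G (H \<union> conjugate G K (inv a)) #> (a \<otimes> b) =
      generate G (H' \<union> conjugate G K' (inv a')) #> (a' \<otimes> b')"
    using assms by blast
next
  fix Z
  assume "\<exists>H'\<in>nontriv_subgroups G. \<exists>K'\<in>nontriv_subgroups G. \<exists>a'\<in>carrier G. \<exists>b'\<in>carrier G.
      H #> a = H' #> a' \<and> K #> b = K' #> b' \<and>
      Z = generate G (H' \<union> conjugate G K' (inv a')) #> (a' \<otimes> b')"
  then obtain H' K' a' b' where *: "H' \<in> nontriv_subgroups G" "K' \<in> nontriv_subgroups G"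
      "a' \<in> carrier G" "b' \<in> carrier G" "H #> a = H' #> a'" "K #> b = K' #> b'"
    and Z: "Z = generate G (H' \<union> conjugate G K' (inv a')) #> (a' \<otimes> b')"
    by blast
  have sg: "subgroup H G" "subgroup K G" "subgroup H' G" "subgroup K' G"
    using assms * by (auto simp: nontriv_subgroups_def)
  interpret H: subgroup H G by fact
  interpret K: subgroup K G by fact
  have H': "H' = H" "a' \<otimes> inv a \<in> H" and K': "K' = K" "b' \<otimes> inv b \<in> K"
    using * sg assms by (auto simp: rcos_eq_iff)
  define h where "h = a' \<otimes> inv a"
  define k where "k = b' \<otimes> inv b"
  have hk: "h \<in> H" "k \<in> K" "h \<in> carrier G" "k \<in> carrier G" using H' K' by (auto simp: h_def k_def)
  have a': "a' = h \<otimes> a" and b': "b' = k \<otimes> b"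
    using assms * by (simp_all add: h_def k_def m_assoc)
  define L where "L = conjugate G K (inv a)"
  have L: "L \<subseteq> carrier G" using K.subset assms conjugate_subset by (simp add: L_def)
  have L': "conjugate G K (inv a') = conjugate G L (inv h)"
    using K.subset assms hk by (simp add: a' L_def conjugate_conjugate inv_mult_group)
  have sgen: "subgroup (generate G (H \<union> S)) G" if "S \<subseteq> carrier G" for S
    using that H.subset by (intro generate_is_subgroup) auto
  have le: "generate G (H \<union> conjugate G S g) \<subseteq> generate G (H \<union> S)"
    if "g \<in> H" "S \<subseteq> carrier G" for S g
  proof (rule generate_subgroup_incl)
    have "g \<in> generate G (H \<union> S)" using that by (auto intro: generate.incl)
    then have "conjugate G (generate G (H \<union> S)) g = generate G (H \<union> S)"
      using conjugate_self[OF sgen[OF that(2)]] by simp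
    then have "conjugate G S g \<subseteq> generate G (H \<union> S)"
      by (metis UnCI conjugate_mono generate.incl subsetI)
    then show "H \<union> conjugate G S g \<subseteq> generate G (H \<union> S)" by (auto intro: generate.incl)
  qed (rule sgen[OF that(2)])
  have "L = conjugate G (conjugate G L (inv h)) h"
    using L hk by (simp add: conjugate_conjugate conjugate_one)
  then have "generate G (H \<union> L) \<subseteq> generate G (H \<union> conjugate G L (inv h))"
    using le[of h "conjugate G L (inv h)"] L hk conjugate_subset by auto
  then have M: "generate G (H \<union> conjugate G L (inv h)) = generate G (H \<union> L)"
    using le[of "inv h" L] hk L by auto
  let ?M = "generate G (H \<union> L)"
  interpret M: subgroup ?M G using sgen L by blast
  have "a \<otimes> k \<otimes> inv a \<in> L" using hk K.subset assms by (simp add: L_def mem_conjugate_iff m_assoc)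
     (simp add: m_assoc[symmetric])
  then have "h \<otimes> (a \<otimes> k \<otimes> inv a) \<in> ?M" using hk
    by (intro M.m_closed[of h "a \<otimes> k \<otimes> inv a"]) (blast intro: generate.incl)+
  moreover have "h \<otimes> (a \<otimes> k \<otimes> inv a) = a' \<otimes> b' \<otimes> inv (a \<otimes> b)"
    using hk assms by (simp add: a' b' inv_mult_group m_assoc) (simp add: m_assoc[symmetric])
  ultimately have "a' \<otimes> b' \<otimes> inv (a \<otimes> b) \<in> ?M" by simp
  then have "?M #> (a \<otimes> b) = ?M #> (a' \<otimes> b')"
    using assms * M.subgroup_axioms by (simp add: rcos_eq_iff)
  then show "Z = generate G (H \<union> conjugate G K (inv a)) #> (a \<otimes> b)"
    unfolding Z H'(1) K'(1) L' M by (simp add: L_def)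
qed

lemma K1_cases:
  assumes "X \<in> K1 G"
  obtains H a where "H \<in> nontriv_subgroups G" "a \<in> carrier G" "X = H #> a"
  using assms by (auto simp: K1_def)

lemma K1_I: "H \<in> nontriv_subgroups G \<Longrightarrow> a \<in> carrier G \<Longrightarrow> H #> a \<in> K1 G"
  by (auto simp: K1_def)

lemma K1_mult_closed: "X \<in> K1 G \<Longrightarrow> Y \<in> K1 G \<Longrightarrow> K1_mult G X Y \<in> K1 G"
  by (elim K1_cases) (simp add: K1_mult_eq K1_I nontriv_generate conjugate_subset nontriv_subset)

lemma generate_Un_generate:
  assumes "A \<subseteq> carrier G" "B \<subseteq> carrier G"
  shows "generate G (generate G A \<union> B) = generate G (A \<union> B)"
    and "generate G (A \<union> generate G B) = generate G (A \<union> B)"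
proof -
  have *: "subgroup (generate G (A \<union> B)) G" using assms by (intro generate_is_subgroup) auto
  have sub: "S \<subseteq> generate G S" for S by (blast intro: generate.incl)
  have A: "generate G A \<subseteq> generate G (A \<union> B)" by (rule mono_generate) simp
  have B: "generate G B \<subseteq> generate G (A \<union> B)" by (rule mono_generate) simp
  show "generate G (generate G A \<union> B) = generate G (A \<union> B)"
  proof
    show "generate G (generate G A \<union> B) \<subseteq> generate G (A \<union> B)"
      by (rule generate_subgroup_incl[OF _ *]) (use A B sub[of B] in blast)
    show "generate G (A \<union> B) \<subseteq> generate G (generate G A \<union> B)"
      by (rule mono_generate) (use sub[of A] in blast)
  qed
  show "generate G (A \<union> generate G B) = generate G (A \<union> B)"
  proof
    show "generate G (A \<union> generate G B) \<subseteq> generate G (A \<union> B)"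
      by (rule generate_subgroup_incl[OF _ *]) (use A B sub[of A] in blast)
    show "generate G (A \<union> B) \<subseteq> generate G (A \<union> generate G B)"
      by (rule mono_generate) (use sub[of B] in blast)
  qed
qed

lemma conjugate_Un: "conjugate G (A \<union> B) g = conjugate G A g \<union> conjugate G B g"
  unfolding conjugate_def r_coset_def l_coset_def by auto

theorem K1_mult_assoc:
  assumes "X \<in> K1 G" "Y \<in> K1 G" "Z \<in> K1 G"
  shows "K1_mult G (K1_mult G X Y) Z = K1_mult G X (K1_mult G Y Z)"
proof -
  obtain H a where X: "H \<in> nontriv_subgroups G" "a \<in> carrier G" "X = H #> a"
    using assms(1) by (rule K1_cases)
  obtain K b where Y: "K \<in> nontriv_subgroups G" "b \<in> carrier G" "Y = K #> b"
    using assms(2) by (rule K1_cases)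
  obtain L c where Z: "L \<in> nontriv_subgroups G" "c \<in> carrier G" "Z = L #> c"
    using assms(3) by (rule K1_cases)
  note s = X Y Z nontriv_subset conjugate_subset
  have "K1_mult G (K1_mult G X Y) Z =
      generate G (H \<union> conjugate G K (inv a) \<union> conjugate G L (inv (a \<otimes> b))) #> (a \<otimes> b \<otimes> c)"
    by (simp add: s K1_mult_eq nontriv_generate generate_Un_generate)
  moreover have "K1_mult G X (K1_mult G Y Z) =
      generate G (H \<union> conjugate G K (inv a) \<union> conjugate G L (inv (a \<otimes> b))) #> (a \<otimes> b \<otimes> c)"
    by (simp add: s K1_mult_eq nontriv_generate conjugate_generate conjugate_Un
        generate_Un_generate conjugate_conjugate inv_mult_group m_assoc Un_assoc)
  ultimately show ?thesis by simp
qed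

lemma generate_subgroup_id: "subgroup H G \<Longrightarrow> generate G H = H"
  by (metis generate_subgroup_incl generate.incl subset_antisym subsetI)

lemma subgroup_of_nontriv: "H \<in> nontriv_subgroups G \<Longrightarrow> subgroup H G"
  by (simp add: nontriv_subgroups_def)

theorem K1_idempotents: "idempotents (K1 G) (K1_mult G) = nontriv_subgroups G"
proof (intro equalityI subsetI)
  fix X assume "X \<in> idempotents (K1 G) (K1_mult G)"
  then have X: "X \<in> K1 G" "K1_mult G X X = X" by (auto simp: idempotents_def)
  obtain H a where H: "H \<in> nontriv_subgroups G" "a \<in> carrier G" "X = H #> a"
    using X(1) by (rule K1_cases)
  let ?M = "generate G (H \<union> conjugate G H (inv a))"
  have "?M #> (a \<otimes> a) = H #> a" using X H by (simp add: K1_mult_eq)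
  moreover have "?M \<in> nontriv_subgroups G"
    using H by (simp add: nontriv_generate conjugate_subset nontriv_subset)
  ultimately have "H = ?M" "a \<otimes> inv (a \<otimes> a) \<in> H"
    using H by (auto simp: rcos_eq_iff subgroup_of_nontriv)
  then have "inv a \<in> H" using H by (simp add: inv_mult_group m_assoc[symmetric])
  then have "a \<in> H" using H by (metis inv_inv subgroup.m_inv_closed subgroup_of_nontriv)
  then have "X = H" using H by (simp add: coset_join2 subgroup_of_nontriv)
  then show "X \<in> nontriv_subgroups G" using H by simp
next
  fix H assume H: "H \<in> nontriv_subgroups G"
  have e: "H = H #> \<one>" using H by (simp add: coset_mult_one nontriv_subset)
  have "K1_mult G (H #> \<one>) (H #> \<one>) = H #> \<one>"
    using H K1_mult_eq[OF H H one_closed one_closed]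
    by (simp add: conjugate_one nontriv_subset generate_subgroup_id subgroup_of_nontriv)
  moreover have "H #> \<one> \<in> K1 G" using H by (simp add: K1_I)
  ultimately show "H \<in> idempotents (K1 G) (K1_mult G)"
    using e by (simp add: idempotents_def)
qed

lemma subgroup_mult_K1:
  assumes "M \<in> nontriv_subgroups G" "K \<in> nontriv_subgroups G" "b \<in> carrier G"
  shows "K1_mult G M (K #> b) = generate G (M \<union> K) #> b"
  using K1_mult_eq[of M K \<one> b] assms by (simp add: conjugate_one nontriv_subset coset_mult_one)

theorem K1_nat_le_iff:
  assumes "X \<in> K1 G" "Y \<in> K1 G"
  shows "nat_le (K1 G) (K1_mult G) X Y \<longleftrightarrow> Y \<subseteq> X"
proof -
  obtain H a where X: "H \<in> nontriv_subgroups G" "a \<in> carrier G" "X = H #> a"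
    using assms(1) by (rule K1_cases)
  obtain K b where Y: "K \<in> nontriv_subgroups G" "b \<in> carrier G" "Y = K #> b"
    using assms(2) by (rule K1_cases)
  note s = subgroup_of_nontriv
  show ?thesis
  proof
    assume "nat_le (K1 G) (K1_mult G) X Y"
    then obtain M where M: "M \<in> nontriv_subgroups G" "X = K1_mult G M Y"
      by (auto simp: nat_le_def K1_idempotents)
    then have "X = generate G (M \<union> K) #> b" using Y by (simp add: subgroup_mult_K1)
    moreover have "generate G (M \<union> K) \<in> nontriv_subgroups G" "K \<subseteq> generate G (M \<union> K)"
      using M Y by (auto simp: nontriv_generate nontriv_subset intro: generate.incl)
    ultimately show "Y \<subseteq> X" using Y
      by (simp add: rcos_subset_iff s subgroup.one_closed)
  next
    assume "Y \<subseteq> X"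
    then have *: "K \<subseteq> H" "b \<otimes> inv a \<in> H" using X Y by (auto simp: rcos_subset_iff s)
    have "generate G (H \<union> K) = H" using * X by (simp add: Un_absorb2 generate_subgroup_id s)
    moreover have "H #> a = H #> b" using * X Y by (simp add: rcos_eq_iff s)
    ultimately have "X = K1_mult G H Y" using X Y by (simp add: subgroup_mult_K1)
    then show "nat_le (K1 G) (K1_mult G) X Y"
      using X(1) assms by (auto simp: nat_le_def K1_idempotents)
  qed
qed

theorem K1_sg_inv:
  assumes "H \<in> nontriv_subgroups G" "a \<in> carrier G"
  shows "sg_inv (K1 G) (K1_mult G) (H #> a) = conjugate G H a #> inv a"
  unfolding sg_inv_def
proof (rule the_equality, intro conjI)
  note s = assms nontriv_subset conjugate_subset nontriv_conjugate subgroup_of_nontriv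
  show "conjugate G H a #> inv a \<in> K1 G" by (simp add: K1_I s)
  show "K1_mult G (K1_mult G (H #> a) (conjugate G H a #> inv a)) (H #> a) = H #> a"
    by (simp add: s K1_mult_eq subgroup_mult_K1 nontriv_generate conjugate_conjugate
        conjugate_one generate_subgroup_id)
  show "K1_mult G (K1_mult G (conjugate G H a #> inv a) (H #> a)) (conjugate G H a #> inv a)
      = conjugate G H a #> inv a"
    by (simp add: s K1_mult_eq subgroup_mult_K1 nontriv_generate conjugate_conjugate
        conjugate_one generate_subgroup_id)
next
  note s = assms nontriv_subset conjugate_subset nontriv_conjugate subgroup_of_nontriv
  fix Y
  assume Y: "Y \<in> K1 G \<and> K1_mult G (K1_mult G (H #> a) Y) (H #> a) = H #> a \<and>
       K1_mult G (K1_mult G Y (H #> a)) Y = Y"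
  then obtain K b where K: "K \<in> nontriv_subgroups G" "b \<in> carrier G" "Y = K #> b"
    using K1_cases by blast
  have gen: "conjugate G Q (inv c) \<subseteq> P" "c \<otimes> d \<in> P"
    if P: "P \<in> nontriv_subgroups G" "c \<in> carrier G"
      and Q: "Q \<in> nontriv_subgroups G" "d \<in> carrier G"
      and eq: "K1_mult G (K1_mult G (P #> c) (Q #> d)) (P #> c) = P #> c" for P c Q d
  proof -
    define M where "M = generate G (generate G (P \<union> conjugate G Q (inv c))
        \<union> conjugate G P (inv (c \<otimes> d)))"
    have M: "M \<in> nontriv_subgroups G"
      using P Q by (simp add: M_def s nontriv_generate)
    have "M #> (c \<otimes> d \<otimes> c) = P #> c"
      using eq P Q by (simp add: M_def K1_mult_eq nontriv_generate s)
    then have *: "M = P" "c \<otimes> inv (c \<otimes> d \<otimes> c) \<in> M"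
      using M P Q by (auto simp: rcos_eq_iff s)
    have "conjugate G Q (inv c) \<subseteq> M" unfolding M_def by (blast intro: generate.incl)
    then show "conjugate G Q (inv c) \<subseteq> P" using *(1) by simp
    have "inv (c \<otimes> inv (c \<otimes> d \<otimes> c)) \<in> P" using * P(1)
      by (metis subgroup.m_inv_closed subgroup_of_nontriv)
    moreover have "inv (c \<otimes> inv (c \<otimes> d \<otimes> c)) = c \<otimes> d"
      using P Q by (simp add: inv_mult_group m_assoc)
    ultimately show "c \<otimes> d \<in> P" by simp
  qed
  have 1: "conjugate G K (inv a) \<subseteq> H" "a \<otimes> b \<in> H" using gen[of H a K b] assms K Y by auto
  have 2: "conjugate G H (inv b) \<subseteq> K" "b \<otimes> a \<in> K" using gen[of K b H a] assms K Y by auto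
  have "K \<subseteq> conjugate G H a" using 1 K assms by (simp add: conjugate_subset_iff s)
  moreover have "conjugate G H a \<subseteq> K"
  proof -
    have "conjugate G (conjugate G H (inv b)) (b \<otimes> a) \<subseteq> conjugate G K (b \<otimes> a)"
      by (rule conjugate_mono) fact
    also have "conjugate G K (b \<otimes> a) = K" using 2 K by (simp add: conjugate_self s)
    finally show ?thesis using K by (simp add: conjugate_conjugate s m_assoc[symmetric])
  qed
  ultimately have KH: "K = conjugate G H a" by auto
  have "inv (b \<otimes> a) \<in> K" using 2 K(1) by (metis subgroup.m_inv_closed subgroup_of_nontriv)
  then have "inv a \<otimes> inv b \<in> K" using K assms by (simp add: inv_mult_group)
  then have "K #> b = K #> inv a" using K by (simp add: rcos_eq_iff s)
  then show "Y = conjugate G H a #> inv a" using K KH by simp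
qed

theorem K1_green_L_iff:
  assumes "H \<in> nontriv_subgroups G" "K \<in> nontriv_subgroups G" "a \<in> carrier G" "b \<in> carrier G"
  shows "green_L (K1 G) (K1_mult G) (H #> a) (K #> b) \<longleftrightarrow> conjugate G H a = conjugate G K b"
proof -
  note s = nontriv_subset conjugate_subset nontriv_conjugate subgroup_of_nontriv
  let ?I = "\<lambda>X. insert X ((\<lambda>s. K1_mult G s X) ` K1 G)"
  have le: "conjugate G P c \<subseteq> conjugate G Q d"
    if P: "P \<in> nontriv_subgroups G" "c \<in> carrier G" and Q: "Q \<in> nontriv_subgroups G" "d \<in> carrier G"
      and i: "Q #> d \<in> ?I (P #> c)" for P c Q d
  proof (cases "Q #> d = P #> c")
    case True
    then have *: "Q = P" "c \<otimes> inv d \<in> Q" using P Q by (auto simp: rcos_eq_iff s)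
    have "conjugate G Q d = conjugate G (conjugate G Q (c \<otimes> inv d)) d"
      using * Q by (simp add: conjugate_self s)
    also have "\<dots> = conjugate G Q c" using P Q by (simp add: conjugate_conjugate s m_assoc)
    finally show ?thesis using * by simp
  next
    case False
    then obtain S where S: "S \<in> K1 G" "Q #> d = K1_mult G S (P #> c)" using i by auto
    then obtain M e where M: "M \<in> nontriv_subgroups G" "e \<in> carrier G" "S = M #> e"
      using K1_cases by blast
    define N where "N = generate G (M \<union> conjugate G P (inv e))"
    have N: "N \<in> nontriv_subgroups G" using M P by (simp add: N_def nontriv_generate s)
    have "Q #> d = N #> (e \<otimes> c)" using S M P by (simp add: N_def K1_mult_eq)
    then have *: "Q = N" "e \<otimes> c \<otimes> inv d \<in> Q" using M N P Q by (auto simp: rcos_eq_iff s)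
    have "conjugate G P (inv e) \<subseteq> N" unfolding N_def by (blast intro: generate.incl)
    then have "conjugate G P (inv e) \<subseteq> Q" using *(1) by simp
    then have "conjugate G (conjugate G P (inv e)) (e \<otimes> c) \<subseteq> conjugate G Q (e \<otimes> c)"
      by (rule conjugate_mono)
    then have "conjugate G P c \<subseteq> conjugate G Q (e \<otimes> c)"
      using P M by (simp add: conjugate_conjugate s m_assoc[symmetric])
    also have "conjugate G Q (e \<otimes> c) = conjugate G (conjugate G Q (e \<otimes> c \<otimes> inv d)) d"
      using P Q M by (simp add: conjugate_conjugate s m_assoc)
    also have "\<dots> = conjugate G Q d" using * Q by (simp add: conjugate_self s)
    finally show ?thesis .
  qed
  have incl: "?I (P #> c) \<subseteq> ?I (Q #> d)"
    if P: "P \<in> nontriv_subgroups G" "c \<in> carrier G" and Q: "Q \<in> nontriv_subgroups G" "d \<in> carrier G"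
      and eq: "conjugate G P c = conjugate G Q d" for P c Q d
  proof -
    let ?Z = "P #> (c \<otimes> inv d)"
    have Z: "?Z \<in> K1 G" using P Q by (simp add: K1_I)
    have "conjugate G Q (inv (c \<otimes> inv d)) = conjugate G (conjugate G Q d) (inv c)"
      using P Q by (simp add: conjugate_conjugate s inv_mult_group)
    also have "\<dots> = P" using P by (simp add: eq[symmetric] conjugate_conjugate conjugate_one s)
    finally have "K1_mult G ?Z (Q #> d) = P #> c"
      using P Q by (simp add: K1_mult_eq generate_subgroup_id s m_assoc)
    moreover have "K1_mult G T (K1_mult G ?Z (Q #> d)) = K1_mult G (K1_mult G T ?Z) (Q #> d)"
      if "T \<in> K1 G" for T
      using that Z Q by (simp add: K1_mult_assoc K1_I)
    ultimately show ?thesis using Z K1_mult_closed by (auto simp: image_iff)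
  qed
  show ?thesis
  proof
    assume "green_L (K1 G) (K1_mult G) (H #> a) (K #> b)"
    then have "?I (H #> a) = ?I (K #> b)" by (simp add: green_L_def)
    then have "K #> b \<in> ?I (H #> a)" "H #> a \<in> ?I (K #> b)" by blast+
    then show "conjugate G H a = conjugate G K b" using le assms by (meson subset_antisym)
  next
    assume "conjugate G H a = conjugate G K b"
    then have "?I (H #> a) = ?I (K #> b)" using incl assms by (metis (no_types, lifting) subset_antisym)
    then show "green_L (K1 G) (K1_mult G) (H #> a) (K #> b)"
      using assms by (simp add: green_L_def K1_I)
  qed
qed

end

end

theory Submission
  imports Defs
begin

text \<open>
  Ranging over representatives, \<open>Ha \<sim> Kb\<close> says that \<open>b a\<^sup>-\<^sup>1 \<in> \<langle>H, K\<rangle>\<close>, together with the same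
  condition for the inverse cosets \<open>H\<^sup>a a\<^sup>-\<^sup>1\<close> and \<open>K\<^sup>b b\<^sup>-\<^sup>1\<close>. This condition multiplies like a
  cocycle (\<open>join_cocycle\<close>), so products and inverses of compatible families are again
  compatible. Meeting each \<open>\<L>\<close>-class once means precisely that \<open>i \<mapsto> i\<^sup>\<tau>\<close> is a bijection.
  Every element of \<open>[A][B]\<close> has the form \<open>\<langle>K, L\<^sup>c\<rangle> a\<^sub>i b\<^sub>j\<close> with \<open>c = a\<^sub>i\<^sup>-\<^sup>1\<close>, \<open>H\<^sub>i \<subseteq> K\<close> and
  \<open>H\<^sub>j \<subseteq> L\<close>; by compatibility of \<open>B\<close> it contains the coset of the minimal subgroup \<open>H\<^sub>i\<close> with
  representative \<open>a\<^sub>i b\<^sub>k\<close>, \<open>k = i\<^sup>\<tau>\<close>, and these cosets are maximal in the natural order.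
\<close>

context group
begin

section \<open>Conjugation, joins and compatibility on representatives\<close>

lemma subgroup_generate_Un:
  assumes "H \<subseteq> carrier G" "K \<subseteq> carrier G"
  shows "subgroup (generate G (H \<union> K)) G"
  using assms by (intro generate_is_subgroup) auto

lemma conjugate_memI:
  assumes "K \<subseteq> carrier G" "g \<in> carrier G" "x \<in> K"
  shows "inv g \<otimes> x \<otimes> g \<in> conjugate G K g"
  using assms(3) unfolding conjugate_def r_coset_def l_coset_def by blast

text \<open>Here \<open>b = h a\<close> with \<open>h\<close> in \<open>H\<close>, and conjugation
  by \<open>h\<close> fixes \<open>H\<close>. This is what makes \<open>tau\<close> independent of
  the representatives.\<close>

lemma conjugate_rcos_eq:
  assumes "subgroup H G" "a \<in> carrier G" "b \<in> carrier G" "H #> a = H #> b"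
  shows "conjugate G H a = conjugate G H b"
proof -
  have sub: "H \<subseteq> carrier G" using assms(1) by (rule subgroup.subset)
  have "b \<otimes> inv a \<in> H" using assms by (simp add: rcos_eq_iff)
  then have "conjugate G H a = conjugate G (conjugate G H (b \<otimes> inv a)) a"
    using assms(1) by (simp add: conjugate_self)
  also have "\<dots> = conjugate G H b" using sub assms by (simp add: conjugate_conjugate m_assoc)
  finally show ?thesis by simp
qed

text \<open>The join contains \<open>K\<close> and is mapped to itself under conjugation by its own
  element \<open>g\<close>.\<close>

lemma generate_conjugate_absorb:
  assumes "H \<subseteq> carrier G" "K \<subseteq> carrier G" "g \<in> generate G (H \<union> K)"
  shows "generate G (H \<union> conjugate G K g) \<subseteq> generate G (H \<union> K)"
proof (rule generate_subgroup_incl)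
  note sg = subgroup_generate_Un[OF assms(1,2)]
  have "conjugate G K g \<subseteq> conjugate G (generate G (H \<union> K)) g"
    by (intro conjugate_mono) (auto intro: generate.incl)
  also have "\<dots> = generate G (H \<union> K)" using sg assms(3) by (rule conjugate_self)
  finally show "H \<union> conjugate G K g \<subseteq> generate G (H \<union> K)" by (auto intro: generate.incl)
  show "subgroup (generate G (H \<union> K)) G" by (rule sg)
qed

text \<open>The element splits as \<open>a' a^-1\<close> times the conjugate
  \<open>a (b' b^-1) a^-1\<close>. That conjugation turns \<open>H^a\<close> back into
  \<open>H\<close> and \<open>K^a'\<close> into the conjugate of \<open>K\<close> by
  \<open>a' a^-1\<close>, which the join absorbs by the first membership hypothesis.\<close>

lemma join_cocycle:
  assumes H: "H \<subseteq> carrier G" and K: "K \<subseteq> carrier G"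
    and c: "a \<in> carrier G" "a' \<in> carrier G" "b \<in> carrier G" "b' \<in> carrier G"
    and a: "a' \<otimes> inv a \<in> generate G (H \<union> K)"
    and b: "b' \<otimes> inv b \<in> generate G (conjugate G H a \<union> conjugate G K a')"
  shows "a' \<otimes> b' \<otimes> inv (a \<otimes> b) \<in> generate G (H \<union> K)"
proof -
  let ?M = "conjugate G H a \<union> conjugate G K a'"
  have M: "?M \<subseteq> carrier G" using H K c conjugate_subset by simp
  have "inv (inv a) \<otimes> (b' \<otimes> inv b) \<otimes> inv a \<in> conjugate G (generate G ?M) (inv a)"
    using b c generate_incl[OF M] by (intro conjugate_memI) auto
  also have "\<dots> = generate G (H \<union> conjugate G K (a' \<otimes> inv a))"
    using H K c M by (simp add: conjugate_generate conjugate_Un conjugate_conjugate conjugate_one)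
  also have "\<dots> \<subseteq> generate G (H \<union> K)"
    using H K a by (rule generate_conjugate_absorb)
  finally have "(a' \<otimes> inv a) \<otimes> (a \<otimes> (b' \<otimes> inv b) \<otimes> inv a) \<in> generate G (H \<union> K)"
    using a c by (auto intro: generate.eng)
  moreover have "(a' \<otimes> inv a) \<otimes> (a \<otimes> (b' \<otimes> inv b) \<otimes> inv a) = a' \<otimes> b' \<otimes> inv (a \<otimes> b)"
    using c by (simp add: inv_mult_group m_assoc) (simp add: m_assoc[symmetric])
  ultimately show ?thesis by simp
qed

text \<open>With \<open>K1_idempotents\<close> this is the test for idempotency of a coset.\<close>

lemma rcos_mem_nontriv_iff:
  assumes "M \<in> nontriv_subgroups G" "c \<in> carrier G"
  shows "M #> c \<in> nontriv_subgroups G \<longleftrightarrow> c \<in> M"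
proof
  assume L: "M #> c \<in> nontriv_subgroups G"
  \<comment> \<open>A subgroup is its own coset by \<open>\<one>\<close>, so
    \<open>rcos_eq_iff\<close> compares the two cosets.\<close>
  then have "M #> c = (M #> c) #> \<one>" by (simp add: coset_mult_one nontriv_subset)
  then have "\<one> \<otimes> inv c \<in> M" using L assms by (simp add: rcos_eq_iff subgroup_of_nontriv)
  then show "c \<in> M" using assms
    by (metis inv_closed inv_inv l_one subgroup.m_inv_closed subgroup_of_nontriv)
next
  assume "c \<in> M"
  then show "M #> c \<in> nontriv_subgroups G"
    using assms by (simp add: coset_join2 subgroup_of_nontriv)
qed

text \<open>For \<open>x = Ha\<close> and \<open>y = Kb\<close>, the product \<open>x y^-1\<close>
  has representative \<open>a b^-1\<close> and \<open>x^-1 y\<close> has \<open>a^-1 b\<close>.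
  Conjugating by \<open>a\<close>, respectively by its inverse, makes the test symmetric in the two
  subgroups: \<open>x y^-1\<close> yields the second condition and \<open>x^-1 y\<close> the
  first.\<close>

lemma K1_compatible_iff:
  assumes "H \<in> nontriv_subgroups G" "K \<in> nontriv_subgroups G" "a \<in> carrier G" "b \<in> carrier G"
  shows "K1_compatible G (H #> a) (K #> b) \<longleftrightarrow>
    b \<otimes> inv a \<in> generate G (H \<union> K) \<and>
    inv b \<otimes> a \<in> generate G (conjugate G H a \<union> conjugate G K b)"
proof -
  note s = assms nontriv_subset conjugate_subset nontriv_conjugate nontriv_generate
    subgroup_of_nontriv
  have flip: "inv x \<in> M \<longleftrightarrow> x \<in> M" if "subgroup M G" "x \<in> carrier G" for M x
    using that by (metis inv_inv subgroup.m_inv_closed)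
  have conj_mem: "inv g \<otimes> x \<otimes> g \<in> conjugate G M g \<longleftrightarrow> x \<in> M"
    if "M \<subseteq> carrier G" "g \<in> carrier G" "x \<in> carrier G" for M g x
  proof -
    have "g \<otimes> (inv g \<otimes> x \<otimes> g) \<otimes> inv g = x"
      using that by (simp add: m_assoc) (simp add: m_assoc[symmetric])
    then show ?thesis using that by (simp add: mem_conjugate_iff)
  qed
  have "K1_mult G (H #> a) (sg_inv (K1 G) (K1_mult G) (K #> b)) \<in> idempotents (K1 G) (K1_mult G)
      \<longleftrightarrow> a \<otimes> inv b \<in> generate G (H \<union> conjugate G K (b \<otimes> inv a))"
    by (simp add: s K1_idempotents K1_sg_inv K1_mult_eq rcos_mem_nontriv_iff conjugate_conjugate)
  also have "\<dots> \<longleftrightarrow> inv a \<otimes> (a \<otimes> inv b) \<otimes> a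
      \<in> conjugate G (generate G (H \<union> conjugate G K (b \<otimes> inv a))) a"
    using assms by (intro conj_mem[symmetric]) (auto simp: s)
  also have "inv a \<otimes> (a \<otimes> inv b) \<otimes> a = inv b \<otimes> a"
    using assms by (simp add: m_assoc[symmetric])
  also have "conjugate G (generate G (H \<union> conjugate G K (b \<otimes> inv a))) a
      = generate G (conjugate G H a \<union> conjugate G K b)"
    by (simp add: s conjugate_generate conjugate_Un conjugate_conjugate m_assoc)
  finally have 1: "K1_mult G (H #> a) (sg_inv (K1 G) (K1_mult G) (K #> b))
      \<in> idempotents (K1 G) (K1_mult G)
      \<longleftrightarrow> inv b \<otimes> a \<in> generate G (conjugate G H a \<union> conjugate G K b)" .
  have "K1_mult G (sg_inv (K1 G) (K1_mult G) (H #> a)) (K #> b) \<in> idempotents (K1 G) (K1_mult G)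
      \<longleftrightarrow> inv a \<otimes> b \<in> conjugate G (generate G (H \<union> K)) a"
    by (simp add: s K1_idempotents K1_sg_inv K1_mult_eq rcos_mem_nontriv_iff
        conjugate_generate conjugate_Un)
  also have "inv a \<otimes> b = inv a \<otimes> (b \<otimes> inv a) \<otimes> a" using assms by (simp add: m_assoc)
  also have "\<dots> \<in> conjugate G (generate G (H \<union> K)) a \<longleftrightarrow> b \<otimes> inv a \<in> generate G (H \<union> K)"
    using assms by (intro conj_mem) (auto simp: s)
  finally show ?thesis using 1 assms by (auto simp: compatible_def K1_I)
qed

end


section \<open>Families of cosets of minimal subgroups\<close>

locale minimal_family = group G for G :: "('a, 'b) monoid_scheme" (structure) +
  fixes I :: "'i set" and H :: "'i \<Rightarrow> 'a set"
  assumes inj: "inj_on H I" and range: "H ` I = minimal_subgroups G"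
begin

section \<open>Minimal subgroups under conjugation\<close>

lemma H_nontriv: "i \<in> I \<Longrightarrow> H i \<in> nontriv_subgroups G"
  using range by (auto simp: minimal_subgroups_def)

lemma H_subset: "i \<in> I \<Longrightarrow> H i \<subseteq> carrier G"
  by (simp add: H_nontriv nontriv_subset)

lemma H_subgroup: "i \<in> I \<Longrightarrow> subgroup (H i) G"
  by (simp add: H_nontriv subgroup_of_nontriv)

lemma H_minimal: "i \<in> I \<Longrightarrow> K \<in> nontriv_subgroups G \<Longrightarrow> K \<subseteq> H i \<Longrightarrow> K = H i"
  using range by (auto simp: minimal_subgroups_def)

text \<open>Conjugation is an inclusion-preserving bijection on non-trivial subgroups, so it
  preserves minimality. This supplies the index that \<open>tau\<close> assigns to
  \<open>i\<close>.\<close>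

lemma conjugate_H_cases:
  assumes "i \<in> I" "g \<in> carrier G"
  obtains j where "j \<in> I" "H j = conjugate G (H i) g"
proof -
  have "K = conjugate G (H i) g"
    if K: "K \<in> nontriv_subgroups G" "K \<subseteq> conjugate G (H i) g" for K
  proof -
    have Kc: "K \<subseteq> carrier G" using K(1) by (rule nontriv_subset)
    have "conjugate G (H i) g = conjugate G (H i) (inv (inv g))" using assms by simp
    then have "conjugate G K (inv g) \<subseteq> H i"
      using K(2) Kc assms by (simp add: conjugate_subset_iff H_subset)
    then have "conjugate G K (inv g) = H i" using K assms by (intro H_minimal nontriv_conjugate) auto
    then have "conjugate G (H i) g = conjugate G (conjugate G K (inv g)) g" by simp
    then show ?thesis using Kc assms by (simp add: conjugate_conjugate conjugate_one)
  qed
  then have "conjugate G (H i) g \<in> H ` I"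
    unfolding range using assms by (simp add: minimal_subgroups_def nontriv_conjugate H_nontriv)
  then show thesis using that by auto
qed

text \<open>A coset determines its subgroup, hence its index; so a family can be recovered, up to
  representatives, from its bare set of cosets.\<close>

lemma rcos_H_eqD:
  assumes "i \<in> I" "j \<in> I" "a \<in> carrier G" "b \<in> carrier G" "H i #> a = H j #> b"
  shows "j = i"
  using assms inj by (auto simp: rcos_eq_iff H_subgroup inj_on_def)

section \<open>Members of the group as representatives with a permutation\<close>

text \<open>Moves the argument from sets of cosets to elements of \<open>G\<close>. The last clause
  is \<open>K1_compatible_iff\<close> with the conjugates renamed through \<open>\<sigma>\<close>;
  \<open>\<sigma> \<in> Bij I\<close> stands for the condition on the
  \<open>\<L>\<close>-classes.\<close>

definition represents :: "('i \<Rightarrow> 'a) \<Rightarrow> ('i \<Rightarrow> 'i) \<Rightarrow> bool" where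
  "represents a \<sigma> \<longleftrightarrow> a \<in> I \<rightarrow> carrier G \<and> \<sigma> \<in> Bij I \<and>
     (\<forall>i \<in> I. H (\<sigma> i) = conjugate G (H i) (a i)) \<and>
     (\<forall>i \<in> I. \<forall>j \<in> I. a j \<otimes> inv (a i) \<in> generate G (H i \<union> H j) \<and>
        inv (a j) \<otimes> a i \<in> generate G (H (\<sigma> i) \<union> H (\<sigma> j)))"

lemma representsD:
  assumes "represents a \<sigma>"
  shows "\<sigma> \<in> Bij I" and "a \<in> I \<rightarrow> carrier G"
    and "i \<in> I \<Longrightarrow> a i \<in> carrier G" and "i \<in> I \<Longrightarrow> \<sigma> i \<in> I"
    and "i \<in> I \<Longrightarrow> H (\<sigma> i) = conjugate G (H i) (a i)"
    and "i \<in> I \<Longrightarrow> conjugate G (H (\<sigma> i)) (inv (a i)) = H i"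
    and "i \<in> I \<Longrightarrow> j \<in> I \<Longrightarrow> a j \<otimes> inv (a i) \<in> generate G (H i \<union> H j)"
    and "i \<in> I \<Longrightarrow> j \<in> I \<Longrightarrow> inv (a j) \<otimes> a i \<in> generate G (H (\<sigma> i) \<union> H (\<sigma> j))"
proof -
  show a: "a i \<in> carrier G" if "i \<in> I" for i using assms that by (auto simp: represents_def)
  show \<sigma>: "H (\<sigma> i) = conjugate G (H i) (a i)" if "i \<in> I" for i
    using assms that by (auto simp: represents_def)
  show "conjugate G (H (\<sigma> i)) (inv (a i)) = H i" if "i \<in> I"
    using that a by (simp add: \<sigma> conjugate_conjugate conjugate_one H_subset)
qed (use assms in \<open>auto simp: represents_def dest: Bij_imp_funcset\<close>)

lemma K1_L_class_iff:
  assumes "i \<in> I" "j \<in> I" "a \<in> carrier G"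
  shows "H i #> a \<in> K1_L_class G (H j) \<longleftrightarrow> conjugate G (H i) a = H j"
proof -
  have "H j #> \<one> = H j" using assms by (simp add: coset_mult_one H_subset)
  then show ?thesis using K1_green_L_iff[of "H i" "H j" a \<one>] assms
    by (simp add: H_nontriv conjugate_one H_subset)
qed

lemma represents_imp_compatible:
  assumes "represents a \<sigma>" "i \<in> I" "j \<in> I"
  shows "K1_compatible G (H i #> a i) (H j #> a j)"
  using assms(2,3) K1_compatible_iff[of "H i" "H j" "a i" "a j"]
    representsD(5)[OF assms(1), symmetric] representsD(3,7,8)[OF assms(1)]
  by (simp add: H_nontriv)

text \<open>The definition of \<open>tau\<close> allows any representative \<open>c\<close> of the
  coset at \<open>i\<close>. Such a coset can only be the one indexed by \<open>i\<close>, and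
  \<open>conjugate_rcos_eq\<close> then makes the conjugate by \<open>c\<close> equal to the one by
  \<open>a i\<close>.\<close>

lemma tau_eq:
  assumes "represents a \<sigma>"
  shows "tau G I H (coset_family G I H a) = \<sigma>"
proof
  fix i
  show "tau G I H (coset_family G I H a) i = \<sigma> i"
  proof (cases "i \<in> I")
    case True
    note r = representsD[OF assms]
    have "(THE j. j \<in> I \<and> (\<exists>c \<in> carrier G. H i #> c \<in> coset_family G I H a \<and>
        H j = conjugate G (H i) c)) = \<sigma> i"
    proof (rule the_equality)
      show "\<sigma> i \<in> I \<and> (\<exists>c \<in> carrier G. H i #> c \<in> coset_family G I H a \<and>
          H (\<sigma> i) = conjugate G (H i) c)"
        using True r by (auto simp: coset_family_def)
    next
      fix j assume "j \<in> I \<and> (\<exists>c \<in> carrier G. H i #> c \<in> coset_family G I H a \<and>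
          H j = conjugate G (H i) c)"
      then obtain c k where j: "j \<in> I" "c \<in> carrier G" "H i #> c = H k #> a k" "k \<in> I"
          "H j = conjugate G (H i) c"
        by (auto simp: coset_family_def)
      then have k: "k = i" using True r(3) by (intro rcos_H_eqD[of i k c "a k"]) auto
      then have "H j = H (\<sigma> i)"
        using j True r(3,5) conjugate_rcos_eq[OF H_subgroup, of i c "a i"] by simp
      then show "j = \<sigma> i" using j(1) True r(4) inj by (auto simp: inj_on_def)
    qed
    then show ?thesis using True by (simp add: tau_def)
  next
    case False
    \<comment> \<open>Off \<open>I\<close> both functions are \<open>undefined\<close>, by
      extensionality.\<close>
    then show ?thesis using representsD(1)[OF assms] Bij_imp_extensional[of \<sigma> I]
      by (simp add: tau_def extensional_def)
  qed
qed

lemma inj_on_rcos: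
  assumes "a \<in> I \<rightarrow> carrier G"
  shows "inj_on (\<lambda>i. H i #> a i) I"
  using assms by (intro inj_onI) (metis rcos_H_eqD PiE)

text \<open>The coset at \<open>k\<close> lies in the class of \<open>H j\<close> exactly when
  \<open>\<sigma> k = j\<close>, so bijectivity leaves one coset in each class.\<close>

lemma represents_imp_compat_sets:
  assumes "represents a \<sigma>"
  shows "coset_family G I H a \<in> compat_sets G I H"
proof -
  note r = representsD[OF assms]
  have "card (coset_family G I H a \<inter> K1_L_class G (H j)) = 1" if j: "j \<in> I" for j
  proof -
    have "j \<in> \<sigma> ` I" using r(1) j by (simp add: Bij_def bij_betw_def)
    then obtain i where i: "i \<in> I" "\<sigma> i = j" by blast
    define L where "L = K1_L_class G (H j)"
    have L: "H k #> a k \<in> L \<longleftrightarrow> k = i" if k: "k \<in> I" for k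
    proof -
      have "H k #> a k \<in> L \<longleftrightarrow> H (\<sigma> k) = H (\<sigma> i)"
        unfolding L_def using K1_L_class_iff[OF k j r(3)[OF k]] r(5)[OF k] i by simp
      also have "\<dots> \<longleftrightarrow> \<sigma> k = \<sigma> i" using k i j r(4) inj by (simp add: inj_on_eq_iff)
      also have "\<dots> \<longleftrightarrow> k = i" using k i r(1) by (auto simp: Bij_def bij_betw_def inj_on_eq_iff)
      finally show ?thesis .
    qed
    then have "coset_family G I H a \<inter> L = {H i #> a i}"
      using i by (auto simp: coset_family_def)
    then have "coset_family G I H a \<inter> K1_L_class G (H j) = {H i #> a i}"
      by (simp only: L_def)
    then show ?thesis by simp
  qed
  then show ?thesis using represents_imp_compatible[OF assms] r(2) unfolding compat_sets_def by blast
qed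

text \<open>Stated for every choice of representatives, because membership in
  \<open>compat_sets\<close> only promises that some choice \<open>a'\<close> satisfies the
  conditions.\<close>

lemma compat_sets_imp_represents:
  assumes a: "a \<in> I \<rightarrow> carrier G" and "coset_family G I H a \<in> compat_sets G I H"
  obtains \<sigma> where "represents a \<sigma>"
proof -
  obtain a' where a': "a' \<in> I \<rightarrow> carrier G" "coset_family G I H a = coset_family G I H a'"
    and compat': "\<And>j k. j \<in> I \<Longrightarrow> k \<in> I \<Longrightarrow> K1_compatible G (H j #> a' j) (H k #> a' k)"
    and card: "\<And>j. j \<in> I \<Longrightarrow> card (coset_family G I H a' \<inter> K1_L_class G (H j)) = 1"
    using assms(2) unfolding compat_sets_def by blast
  \<comment> \<open>Equal sets of cosets agree index by index, so the conditions pass from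
    \<open>a'\<close> to \<open>a\<close>.\<close>
  have aa': "H i #> a' i = H i #> a i" if i: "i \<in> I" for i
  proof -
    have "H i #> a i \<in> coset_family G I H a'"
      unfolding a'(2)[symmetric] using i by (simp add: coset_family_def)
    then obtain k where k: "k \<in> I" "H i #> a i = H k #> a' k" by (auto simp: coset_family_def)
    then have "k = i" using i a a' by (intro rcos_H_eqD[of i k "a i" "a' k"]) auto
    then show ?thesis using k by simp
  qed
  have compat: "K1_compatible G (H j #> a j) (H k #> a k)" if "j \<in> I" "k \<in> I" for j k
    using compat'[OF that] that by (simp only: aa')
  have "\<forall>i\<in>I. \<exists>j. j \<in> I \<and> H j = conjugate G (H i) (a i)"
    using a by (meson conjugate_H_cases PiE)
  then obtain s where s: "\<And>i. i \<in> I \<Longrightarrow> s i \<in> I"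
      "\<And>i. i \<in> I \<Longrightarrow> H (s i) = conjugate G (H i) (a i)"
    by metis
  have L: "H i #> a i \<in> K1_L_class G (H j) \<longleftrightarrow> s i = j" if "i \<in> I" "j \<in> I" for i j
    using that a s inj K1_L_class_iff[of i j "a i"] by (auto simp flip: s(2) simp: inj_on_eq_iff)
  have ex1: "\<exists>!i. i \<in> I \<and> s i = j" if j: "j \<in> I" for j
  proof -
    obtain X where X: "coset_family G I H a \<inter> K1_L_class G (H j) = {X}"
      using card[OF j] a'(2) by (auto simp: card_1_singleton_iff)
    \<comment> \<open>Every preimage of \<open>j\<close> indexes the single coset \<open>X\<close>;
      since a coset determines its index, the preimage is unique.\<close>
    have mem: "H i #> a i = X" if "i \<in> I" "s i = j" for i
      using X L[OF that(1) j] that by (auto simp: coset_family_def)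
    have "X \<in> coset_family G I H a" "X \<in> K1_L_class G (H j)" using X by blast+
    then obtain i where i: "i \<in> I" "s i = j" using L j by (auto simp only: coset_family_def)
    show ?thesis
    proof (rule ex1I[of _ i])
      fix k assume "k \<in> I \<and> s k = j"
      then show "k = i" using mem[of k] mem[of i] i inj_onD[OF inj_on_rcos[OF a], of k i] by simp
    qed (use i in simp)
  qed
  have "inj_on s I" by (rule inj_onI) (use s(1) ex1 in blast)
  moreover have "s ` I = I" using s(1) ex1 by (intro equalityI subsetI) blast+
  ultimately have "bij_betw s I I" by (simp add: bij_betw_def)
  \<comment> \<open>Elements of \<open>Bij I\<close> are extensional, whereas \<open>s\<close> is
    arbitrary off \<open>I\<close>.\<close>
  then have "restrict s I \<in> Bij I" by (simp add: Bij_def)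
  moreover have "a j \<otimes> inv (a i) \<in> generate G (H i \<union> H j) \<and>
      inv (a j) \<otimes> a i \<in> generate G (H (s i) \<union> H (s j))" if "i \<in> I" "j \<in> I" for i j
    using compat[OF that] that a K1_compatible_iff[of "H i" "H j" "a i" "a j"]
    by (auto simp: H_nontriv s)
  ultimately have "represents a (restrict s I)"
    using a s by (simp add: represents_def)
  then show thesis by (rule that)
qed

lemma compat_sets_cases:
  assumes "A \<in> compat_sets G I H"
  obtains a \<sigma> where "A = coset_family G I H a" "represents a \<sigma>"
proof -
  obtain a where "A = coset_family G I H a" "a \<in> I \<rightarrow> carrier G"
    using assms by (auto simp: compat_sets_def)
  then show thesis using assms that by (metis compat_sets_imp_represents)
qed

section \<open>Products, identity and inverses of representations\<close>

text \<open>Conjugating \<open>H i\<close> by \<open>a i\<close> and then by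
  \<open>b (\<sigma> i)\<close> follows \<open>\<sigma>\<close> and then \<open>\<rho>\<close>. Both
  compatibility conditions are instances of \<open>join_cocycle\<close>.\<close>

lemma represents_mult:
  assumes "represents a \<sigma>" "represents b \<rho>"
  shows "represents (\<lambda>i. a i \<otimes> b (\<sigma> i)) (compose I \<rho> \<sigma>)"
proof -
  note ra = representsD[OF assms(1)] and rb = representsD[OF assms(2)]
  have conj: "H (\<rho> (\<sigma> i)) = conjugate G (H i) (a i \<otimes> b (\<sigma> i))" if "i \<in> I" for i
    using that ra rb by (simp add: conjugate_conjugate H_subset)
  moreover have "a j \<otimes> b (\<sigma> j) \<otimes> inv (a i \<otimes> b (\<sigma> i)) \<in> generate G (H i \<union> H j)"
    if ij: "i \<in> I" "j \<in> I" for i j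
    using rb(7)[OF ra(4)[OF ij(1)] ra(4)[OF ij(2)]] ij ra rb
    by (intro join_cocycle) (simp_all add: H_subset)
  moreover have "inv (a j \<otimes> b (\<sigma> j)) \<otimes> (a i \<otimes> b (\<sigma> i))
      \<in> generate G (H (\<rho> (\<sigma> i)) \<union> H (\<rho> (\<sigma> j)))" if ij: "i \<in> I" "j \<in> I" for i j
  proof -
    \<comment> \<open>Inversion reverses the factors, so the cocycle starts at the subgroups indexed
      by \<open>\<rho> (\<sigma> i)\<close> and \<open>\<rho> (\<sigma> j)\<close>, with the
      inverses of the \<open>b\<close> values acting first.\<close>
    have "inv (b (\<sigma> j)) \<otimes> inv (a j) \<otimes> inv (inv (b (\<sigma> i)) \<otimes> inv (a i))
        \<in> generate G (H (\<rho> (\<sigma> i)) \<union> H (\<rho> (\<sigma> j)))"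
    proof (rule join_cocycle)
      show "inv (b (\<sigma> j)) \<otimes> inv (inv (b (\<sigma> i))) \<in> generate G (H (\<rho> (\<sigma> i)) \<union> H (\<rho> (\<sigma> j)))"
        using rb(8)[OF ra(4)[OF ij(1)] ra(4)[OF ij(2)]] ij ra rb by simp
      show "inv (a j) \<otimes> inv (inv (a i)) \<in> generate G
          (conjugate G (H (\<rho> (\<sigma> i))) (inv (b (\<sigma> i))) \<union> conjugate G (H (\<rho> (\<sigma> j))) (inv (b (\<sigma> j))))"
        using ra(8)[OF ij] ij ra(3,4) by (simp add: rb(6))
    qed (use ij ra(3,4) rb(3,4) in \<open>simp_all add: H_subset\<close>)
    then show ?thesis using ij ra(3,4) rb(3) by (simp add: inv_mult_group)
  qed
  moreover have "compose I \<rho> \<sigma> \<in> Bij I" using ra(1) rb(1) by (intro compose_Bij)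
  ultimately show ?thesis using ra(3,4) rb(3)
    by (auto simp: represents_def compose_eq)
qed

lemma represents_one: "represents (\<lambda>i. \<one>) (\<lambda>i \<in> I. i)"
  using id_Bij[of I]
  by (auto simp: represents_def conjugate_one H_subset intro: generate.one)

text \<open>The inverse of the coset at \<open>i\<close> has subgroup \<open>H (\<sigma> i)\<close>
  and representative \<open>inv (a i)\<close>; reindexing by the inverse of \<open>\<sigma>\<close>
  gives this family. Inversion exchanges the two compatibility conditions.\<close>

lemma represents_inverse:
  assumes "represents a \<sigma>"
  shows "represents (\<lambda>j. inv (a (inv_into I \<sigma> j))) (restrict (inv_into I \<sigma>) I)"
proof -
  note r = representsD[OF assms]
  have b: "bij_betw \<sigma> I I" using r(1) by (simp add: Bij_def)
  have inI: "inv_into I \<sigma> j \<in> I" and \<sigma>: "\<sigma> (inv_into I \<sigma> j) = j" if "j \<in> I" for j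
    using that b by (auto simp: bij_betw_def intro: inv_into_into f_inv_into_f)
  have "conjugate G (H j) (inv (a (inv_into I \<sigma> j))) = H (inv_into I \<sigma> j)" if "j \<in> I" for j
    using r(6)[OF inI[OF that]] \<sigma>[OF that] by simp
  moreover have "inv (a (inv_into I \<sigma> j)) \<otimes> a (inv_into I \<sigma> i) \<in> generate G (H i \<union> H j)"
    if "i \<in> I" "j \<in> I" for i j
    using r(8)[OF inI[OF that(1)] inI[OF that(2)]] \<sigma> that by simp
  moreover have "a (inv_into I \<sigma> j) \<otimes> inv (a (inv_into I \<sigma> i)) \<in>
      generate G (H (inv_into I \<sigma> i) \<union> H (inv_into I \<sigma> j))" if "i \<in> I" "j \<in> I" for i j
    using r(7)[OF inI[OF that(1)] inI[OF that(2)]] .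
  ultimately show ?thesis
    using restrict_inv_into_Bij[OF r(1)] inI r(3) by (simp add: represents_def)
qed

section \<open>Order ideals and the multiplication formula\<close>

text \<open>Below in the natural order means larger as a set. A coset \<open>Kc\<close> containing
  the coset at \<open>i\<close> contains \<open>a i\<close>, which can therefore replace
  \<open>c\<close>.\<close>

lemma mem_order_ideal_coset_family:
  assumes "a \<in> I \<rightarrow> carrier G"
  shows "X \<in> order_ideal (K1 G) (K1_mult G) (coset_family G I H a) \<longleftrightarrow>
    (\<exists>i \<in> I. \<exists>K \<in> nontriv_subgroups G. H i \<subseteq> K \<and> X = K #> a i)"
proof
  assume "X \<in> order_ideal (K1 G) (K1_mult G) (coset_family G I H a)"
  then obtain i where i: "i \<in> I" "X \<in> K1 G" "nat_le (K1 G) (K1_mult G) X (H i #> a i)"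
    by (auto simp: order_ideal_def coset_family_def)
  then obtain K c where K: "K \<in> nontriv_subgroups G" "c \<in> carrier G" "X = K #> c"
    using K1_cases by blast
  have ai: "a i \<in> carrier G" using i assms by auto
  have "H i #> a i \<subseteq> K #> c" using i K ai by (simp add: K1_nat_le_iff K1_I H_nontriv)
  then have "H i \<subseteq> K" "a i \<otimes> inv c \<in> K"
    using i K ai by (auto simp: rcos_subset_iff H_subgroup subgroup_of_nontriv)
  then have "H i \<subseteq> K \<and> X = K #> a i" using K ai by (simp add: rcos_eq_iff subgroup_of_nontriv)
  then show "\<exists>i \<in> I. \<exists>K \<in> nontriv_subgroups G. H i \<subseteq> K \<and> X = K #> a i" using i K by blast
next
  assume "\<exists>i \<in> I. \<exists>K \<in> nontriv_subgroups G. H i \<subseteq> K \<and> X = K #> a i"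
  then obtain i K where i: "i \<in> I" "K \<in> nontriv_subgroups G" "H i \<subseteq> K" "X = K #> a i" by blast
  have ai: "a i \<in> carrier G" using i assms by auto
  have "H i #> a i \<subseteq> X"
    using i ai by (simp add: rcos_subset_iff H_subgroup subgroup_of_nontriv subgroup.one_closed)
  then have "nat_le (K1 G) (K1_mult G) X (H i #> a i)"
    using i ai by (simp add: K1_nat_le_iff K1_I H_nontriv)
  then show "X \<in> order_ideal (K1 G) (K1_mult G) (coset_family G I H a)"
    using i ai by (auto simp: order_ideal_def coset_family_def K1_I)
qed

text \<open>Maximal in the natural order means minimal under inclusion. Thus it suffices that the
  cosets \<open>?c i\<close> lie in \<open>P\<close>, that each member of \<open>P\<close> contains
  one of them, and that no coset lies properly inside one.\<close>

lemma compat_mult_eq: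
  assumes "represents a \<sigma>" "represents b \<rho>"
  shows "compat_mult G (coset_family G I H a) (coset_family G I H b) =
    coset_family G I H (\<lambda>i. a i \<otimes> b (\<sigma> i))"
proof -
  note ra = representsD[OF assms(1)] and rb = representsD[OF assms(2)]
  note s = H_nontriv H_subset H_subgroup nontriv_subset conjugate_subset nontriv_conjugate
    nontriv_generate subgroup_of_nontriv ra(3,4) rb(3,4)
  define P where "P = {K1_mult G X Y | X Y.
    X \<in> order_ideal (K1 G) (K1_mult G) (coset_family G I H a) \<and>
    Y \<in> order_ideal (K1 G) (K1_mult G) (coset_family G I H b)}"
  let ?c = "\<lambda>i. H i #> (a i \<otimes> b (\<sigma> i))"
  have P_K1: "P \<subseteq> K1 G" unfolding P_def order_ideal_def by (auto intro: K1_mult_closed)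
  have c_mem: "?c i \<in> P" if i: "i \<in> I" for i
  proof -
    \<comment> \<open>Conjugating \<open>H (\<sigma> i)\<close> by \<open>inv (a i)\<close> gives
      \<open>H i\<close> again, so the join collapses to \<open>H i\<close>.\<close>
    have "K1_mult G (H i #> a i) (H (\<sigma> i) #> b (\<sigma> i)) = ?c i"
      using i by (simp add: s K1_mult_eq ra(6) generate_subgroup_id)
    moreover have "H i #> a i \<in> order_ideal (K1 G) (K1_mult G) (coset_family G I H a)"
      using i H_nontriv by (auto simp: mem_order_ideal_coset_family[OF ra(2)])
    moreover have "H (\<sigma> i) #> b (\<sigma> i) \<in> order_ideal (K1 G) (K1_mult G) (coset_family G I H b)"
      using i ra(4) H_nontriv by (auto simp: mem_order_ideal_coset_family[OF rb(2)])
    ultimately show ?thesis unfolding P_def by blast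
  qed
  have above: "\<exists>i \<in> I. ?c i \<subseteq> Z" if "Z \<in> P" for Z
  proof -
    obtain i j K L where i: "i \<in> I" "K \<in> nontriv_subgroups G" "H i \<subseteq> K"
      and j: "j \<in> I" "L \<in> nontriv_subgroups G" "H j \<subseteq> L"
      and Z: "Z = K1_mult G (K #> a i) (L #> b j)"
      using \<open>Z \<in> P\<close> unfolding P_def
      by (auto simp: mem_order_ideal_coset_family[OF ra(2)] mem_order_ideal_coset_family[OF rb(2)])
    let ?N = "generate G (K \<union> conjugate G L (inv (a i)))"
    let ?x = "b (\<sigma> i) \<otimes> inv (b j)"
    \<comment> \<open>Compatibility of the second family, at \<open>j\<close> and
      \<open>\<sigma> i\<close>, measures how far \<open>b j\<close> is from the wanted
      \<open>b (\<sigma> i)\<close>. Conjugation by \<open>inv (a i)\<close> carries this difference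
      into \<open>?N\<close>.\<close>
    have "?x \<in> generate G (H j \<union> H (\<sigma> i))" using i j ra(4) by (intro rb(7)) auto
    then have "inv (inv (a i)) \<otimes> ?x \<otimes> inv (a i)
        \<in> conjugate G (generate G (H j \<union> H (\<sigma> i))) (inv (a i))"
      using i j by (intro conjugate_memI) (simp_all add: s)
    also have "\<dots> = generate G (conjugate G (H j) (inv (a i)) \<union> H i)"
      using i j by (simp add: s conjugate_generate conjugate_Un ra(6))
    also have "\<dots> \<subseteq> ?N"
      using conjugate_mono[OF j(3)] i(3) by (intro mono_generate) blast
    finally have "(a i \<otimes> b (\<sigma> i)) \<otimes> inv (a i \<otimes> b j) \<in> ?N"
      using i j by (simp add: s inv_mult_group m_assoc)
    moreover have "H i \<subseteq> ?N" using i(3) by (auto intro: generate.incl)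
    ultimately have "?c i \<subseteq> ?N #> (a i \<otimes> b j)"
      using i j by (simp add: s rcos_subset_iff)
    then show ?thesis using i j by (auto simp: Z s K1_mult_eq)
  qed
  have maximal: "Y = ?c i" if "i \<in> I" and Y: "Y \<in> K1 G" and "Y \<subseteq> ?c i" for Y i
  proof -
    obtain M m where M: "M \<in> nontriv_subgroups G" "m \<in> carrier G" "Y = M #> m"
      using Y by (rule K1_cases)
    have *: "M \<subseteq> H i" "m \<otimes> inv (a i \<otimes> b (\<sigma> i)) \<in> H i"
      using that M by (auto simp: rcos_subset_iff s)
    \<comment> \<open>Minimality fixes the subgroup, and nested cosets of one subgroup
      coincide.\<close>
    then have "M = H i" using that M by (intro H_minimal)
    then show ?thesis using * that M by (metis rcos_eq_iff H_subgroup m_closed ra(3,4) rb(3))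
  qed
  have "maximal_elements (K1 G) (K1_mult G) P = ?c ` I"
  proof
    show "?c ` I \<subseteq> maximal_elements (K1 G) (K1_mult G) P"
      using c_mem maximal P_K1 by (force simp: maximal_elements_def K1_nat_le_iff subset_iff)
    show "maximal_elements (K1 G) (K1_mult G) P \<subseteq> ?c ` I"
    proof
      fix Z assume Z: "Z \<in> maximal_elements (K1 G) (K1_mult G) P"
      then have "Z \<in> P" by (simp add: maximal_elements_def)
      then obtain i where i: "i \<in> I" "?c i \<subseteq> Z" using above by blast
      have "nat_le (K1 G) (K1_mult G) Z (?c i)"
        using i c_mem \<open>Z \<in> P\<close> P_K1 by (subst K1_nat_le_iff) auto
      then show "Z \<in> ?c ` I" using Z i c_mem by (auto simp: maximal_elements_def)
    qed
  qed
  then show ?thesis by (simp add: compat_mult_def P_def coset_family_def)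
qed

section \<open>The group of compatible sets\<close>

lemma coset_family_cong:
  "(\<And>i. i \<in> I \<Longrightarrow> a i = b i) \<Longrightarrow> coset_family G I H a = coset_family G I H b"
  by (auto simp: coset_family_def)

lemma coset_family_one: "coset_family G I H (\<lambda>i. \<one>) = H ` I"
  by (auto simp: coset_family_def coset_mult_one H_subset)

lemma group_compat_group: "group (compat_group G I H)"
proof (rule groupI, unfold compat_group_def monoid.simps partial_object.simps)
  fix A B assume "A \<in> compat_sets G I H" "B \<in> compat_sets G I H"
  then obtain a \<sigma> b \<rho> where "A = coset_family G I H a" "represents a \<sigma>"
      "B = coset_family G I H b" "represents b \<rho>"
    by (metis compat_sets_cases)
  then show "compat_mult G A B \<in> compat_sets G I H"
    by (simp add: compat_mult_eq represents_imp_compat_sets[OF represents_mult])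
next
  show "H ` I \<in> compat_sets G I H"
    using represents_imp_compat_sets[OF represents_one] by (simp add: coset_family_one)
next
  fix A B C assume "A \<in> compat_sets G I H" "B \<in> compat_sets G I H" "C \<in> compat_sets G I H"
  then obtain a \<sigma> b \<rho> c \<pi> where *: "A = coset_family G I H a" "represents a \<sigma>"
      "B = coset_family G I H b" "represents b \<rho>" "C = coset_family G I H c" "represents c \<pi>"
    by (metis compat_sets_cases)
  note r = representsD(3,4)[OF *(2)] representsD(3,4)[OF *(4)] representsD(3,4)[OF *(6)]
  \<comment> \<open>On \<open>I\<close>, both bracketings have representative \<open>a i\<close>
    times \<open>b (\<sigma> i)\<close> times \<open>c (\<rho> (\<sigma> i))\<close>.\<close>
  show "compat_mult G (compat_mult G A B) C = compat_mult G A (compat_mult G B C)"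
    using * represents_mult[OF *(2,4)] represents_mult[OF *(4,6)]
    by (simp add: compat_mult_eq) (intro coset_family_cong, simp add: compose_eq m_assoc r)
next
  fix A assume "A \<in> compat_sets G I H"
  then obtain a \<sigma> where a: "A = coset_family G I H a" "represents a \<sigma>"
    by (rule compat_sets_cases)
  have "compat_mult G (H ` I) A = coset_family G I H (\<lambda>i. \<one> \<otimes> a ((\<lambda>i \<in> I. i) i))"
    using compat_mult_eq[OF represents_one a(2)] by (simp only: coset_family_one a(1))
  also have "\<dots> = A" unfolding a(1)
    by (intro coset_family_cong) (simp add: representsD(3)[OF a(2)])
  finally show "compat_mult G (H ` I) A = A" .
  \<comment> \<open>Only a left inverse is required by \<open>groupI\<close>; the family of
    \<open>represents_inverse\<close> provides it.\<close>
  let ?b = "\<lambda>j. inv (a (inv_into I \<sigma> j))"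
  have r: "represents ?b (restrict (inv_into I \<sigma>) I)" by (rule represents_inverse[OF a(2)])
  have "compat_mult G (coset_family G I H ?b) A = coset_family G I H (\<lambda>i. \<one>)"
    unfolding a(1) compat_mult_eq[OF r a(2)]
  proof (rule coset_family_cong)
    fix i assume i: "i \<in> I"
    then have "a (inv_into I \<sigma> i) \<in> carrier G"
      using representsD(4)[OF r i] by (simp add: representsD(3)[OF a(2)])
    then show "?b i \<otimes> a (restrict (inv_into I \<sigma>) I i) = \<one>" using i by simp
  qed
  then show "\<exists>B \<in> compat_sets G I H. compat_mult G B A = H ` I"
    using represents_imp_compat_sets[OF r] by (auto simp: coset_family_one)
qed

end

section \<open>The symmetric group and the homomorphism \<open>tau\<close>\<close>

text \<open>This is the opposite group of \<open>BijGroup I\<close>; the inverse there serves on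
  either side.\<close>

lemma group_Sym: "group (Sym I)"
proof -
  interpret B: group "BijGroup I" by (rule group_BijGroup)
  show ?thesis
  proof (rule groupI)
    fix x assume "x \<in> carrier (Sym I)"
    then show "\<exists>y \<in> carrier (Sym I). y \<otimes>\<^bsub>Sym I\<^esub> x = \<one>\<^bsub>Sym I\<^esub>"
      by (auto simp: Sym_def intro: bexI[of _ "inv\<^bsub>BijGroup I\<^esub> x"])
  qed (auto simp: Sym_def B.m_assoc)
qed

context minimal_family
begin

text \<open>By \<open>represents_mult\<close> the product has permutation
  \<open>compose I \<rho> \<sigma>\<close>, which applies \<open>\<sigma>\<close> first; this is the
  product of \<open>\<sigma>\<close> and \<open>\<rho>\<close> in the reversed multiplication of
  \<open>Sym\<close>.\<close>

lemma tau_hom: "tau G I H \<in> hom (compat_group G I H) (Sym I)"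
proof (rule homI)
  fix A assume "A \<in> carrier (compat_group G I H)"
  then obtain a \<sigma> where "A = coset_family G I H a" "represents a \<sigma>"
    using compat_sets_cases by (auto simp: compat_group_def)
  then show "tau G I H A \<in> carrier (Sym I)"
    by (simp add: tau_eq Sym_def BijGroup_def representsD(1))
next
  fix A B assume "A \<in> carrier (compat_group G I H)" "B \<in> carrier (compat_group G I H)"
  then obtain a \<sigma> b \<rho> where *: "A = coset_family G I H a" "represents a \<sigma>"
      "B = coset_family G I H b" "represents b \<rho>"
    by (auto simp: compat_group_def elim!: compat_sets_cases)
  then show "tau G I H (A \<otimes>\<^bsub>compat_group G I H\<^esub> B) = tau G I H A \<otimes>\<^bsub>Sym I\<^esub> tau G I H B"
    using tau_eq[OF represents_mult[OF *(2,4)]] representsD(1)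
    by (simp add: compat_group_def compat_mult_eq tau_eq Sym_def BijGroup_def)
qed

end


theorem proposition3p2:
  fixes G :: "('a, 'b) monoid_scheme" and I :: "'i set" and H :: "'i \<Rightarrow> 'a set"
  assumes "periodic_group G" and "carrier G \<noteq> {\<one>\<^bsub>G\<^esub>}"
    and "inj_on H I" and "H ` I = minimal_subgroups G"
  shows "(\<forall>a \<in> I \<rightarrow> carrier G. coset_family G I H a \<in> compat_sets G I H \<longrightarrow>
            tau G I H (coset_family G I H a) \<in> Bij I \<and>
            (\<forall>i \<in> I. \<forall>j \<in> I. tau G I H (coset_family G I H a) i = j \<longleftrightarrow>
                               H j = conjugate G (H i) (a i))) \<and>
         (\<forall>a \<in> I \<rightarrow> carrier G. \<forall>b \<in> I \<rightarrow> carrier G.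
            coset_family G I H a \<in> compat_sets G I H \<longrightarrow>
            coset_family G I H b \<in> compat_sets G I H \<longrightarrow>
            coset_family G I H a \<otimes>\<^bsub>compat_group G I H\<^esub> coset_family G I H b =
            coset_family G I H
              (\<lambda>i. a i \<otimes>\<^bsub>G\<^esub> b (tau G I H (coset_family G I H a) i))) \<and>
         group_hom (compat_group G I H) (Sym I) (tau G I H)"
proof -
  interpret group G using assms(1) by (simp add: periodic_group_def)
  interpret minimal_family G I H using assms(3,4) by unfold_locales
  have "tau G I H (coset_family G I H a) \<in> Bij I \<and>
      (\<forall>i \<in> I. \<forall>j \<in> I. tau G I H (coset_family G I H a) i = j \<longleftrightarrow> H j = conjugate G (H i) (a i))"
    if a: "a \<in> I \<rightarrow> carrier G" "coset_family G I H a \<in> compat_sets G I H" for a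
  proof -
    obtain \<sigma> where \<sigma>: "represents a \<sigma>" using a by (rule compat_sets_imp_represents)
    \<comment> \<open>Distinctness of the minimal subgroups turns the equation between subgroups
      into one between indices.\<close>
    then have "H (\<sigma> i) = H j \<longleftrightarrow> \<sigma> i = j" if "i \<in> I" "j \<in> I" for i j
      using that assms(3) representsD(4)[OF \<sigma>] by (simp add: inj_on_eq_iff)
    then show ?thesis using \<sigma> by (metis tau_eq representsD(1,5))
  qed
  moreover have "coset_family G I H a \<otimes>\<^bsub>compat_group G I H\<^esub> coset_family G I H b =
      coset_family G I H (\<lambda>i. a i \<otimes>\<^bsub>G\<^esub> b (tau G I H (coset_family G I H a) i))"
    if ab: "a \<in> I \<rightarrow> carrier G" "b \<in> I \<rightarrow> carrier G" "coset_family G I H a \<in> compat_sets G I H"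
      "coset_family G I H b \<in> compat_sets G I H" for a b
  proof -
    obtain \<sigma> where "represents a \<sigma>" using ab(1,3) by (rule compat_sets_imp_represents)
    moreover obtain \<rho> where "represents b \<rho>" using ab(2,4) by (rule compat_sets_imp_represents)
    ultimately show ?thesis by (simp add: compat_group_def compat_mult_eq tau_eq)
  qed
  moreover have "group_hom (compat_group G I H) (Sym I) (tau G I H)"
    by (simp add: group_hom_def group_hom_axioms_def group_compat_group group_Sym tau_hom)
  ultimately show ?thesis by blast
qed

end
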